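(* Let $f:\mathbb{R}^{n_\phi}\to\mathbb{R}^p$ have bounded gain and let $\mathcal{S}\subset\mathbb{R}^{p\times d_y}$ be a bounded set. Suppose that a controller $(g_1,g_2,h,\mathcal{X})$ of the form described in the context provides a convolution bound for $(f,\mathcal{S})$ with gain $c\ge 1$ and decay rate $\lambda\in(0,1)$. Then there exists an $\epsilon>0$ such that for every $c_0\ge0$ there exist $\lambda_*\in(0,1)$ and $\gamma>0$ such that the same controller provides a convolution bound for $(f,s(\mathcal{S},c_0,\epsilon))$ with gain $\gamma$ and decay rate $\lambda_*$.
   Context: Notation. $\|\cdot\|$ is the Euclidean norm of a vector and the corresponding induced norm of a matrix. $\mathbb{S}(\mathbb{R}^{k})$ is the set of all $\mathbb{R}^{k}$-valued sequences (indexed by $\mathbb{Z}$), and $\boldsymbol\ell_\infty(\mathbb{R}^{p\times d_y})$ is the set of bounded $\mathbb{R}^{p\times d_y}$-valued sequences indexed by $\mathbb{Z}$. A function $\Gamma:\mathbb{R}^a\to\mathbb{R}^b$ has a bounded gain if there is $\nu>0$ with $\|\Gamma(x)\|\le\nu\|x\|$ for all $x\in\mathbb{R}^a$. Plant. Fix dimensions $d_y,d_u,p,n_y,n_u\in\mathbb{N}$ and put $n_\phi=n_y d_y+n_u d_u$. With output $y(t)\in\mathbb{R}^{d_y}$, input $u(t)\in\mathbb{R}^{d_u}$ and disturbance $w(t)\in\mathbb{R}^{d_y}$, let $\phi(t)\in\mathbb{R}^{n_\phi}$ be the column vector obtained by stacking $y(t),y(t-1),\dots,y(t-n_y+1),u(t),u(t-1),\dots,u(t-n_u+1)$.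 For a constant parameter $\theta^*\in\mathcal{S}$ the time-invariant plant is $$y(t+1)={\theta^*}^\top f(\phi(t))+w(t),\quad t\ge t_0,\qquad \phi(t_0)=\phi_0,$$ and for a parameter sequence $\theta^*(\cdot)$ the time-varying plant is $$y(t+1)=\theta^*(t)^\top f(\phi(t))+w(t),\quad t\ge t_0,\qquad \phi(t_0)=\phi_0.$$ Controller. Fix integers $l_1,l_2,q\ge0$ and a set $\mathcal{X}\subset\mathbb{R}^{l_2}$. The controller has states $z_1(t)\in\mathbb{R}^{l_1}$, $z_2(t)\in\mathbb{R}^{l_2}$ and an exogenous signal $r(t)\in\mathbb{R}^q$, and is given for $t\ge t_0$ by $$z_1(t+1)=g_1(z_1(t),z_2(t),\phi(t),y(t+1),r(t),t,t_0),\quad z_1(t_0)=z_{1_0},$$ $$z_2(t+1)=g_2(z_1(t),z_2(t),\phi(t),y(t+1),r(t),t,t_0),\quad z_2(t_0)=z_{2_0},$$ $$u(t)=h(z_1(t),z_2(t),\phi(t),r(t)),$$ where $g_1$ is $\mathbb{R}^{l_1}$-valued, $h$ is $\mathbb{R}^{d_u}$-valued, and $g_2:\mathbb{R}^{l_1}\times\mathcal{X}\times\mathbb{R}^{n_\phi}\times\mathbb{R}^{d_y}\times\mathbb{R}^q\times\mathbb{Z}\times\mathbb{Z}\to\mathcal{X}$ (so $z_2$ stays in $\mathcal{X}$ if $z_{2_0}\in\mathcal{X}$). Applying the controller to a plant means that $y,u,z_1,z_2$ satisfy the plant and controller equations simultaneously for all $t\ge t_0$. Convolution bound for $(f,\mathcal{S})$.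 The controller provides a convolution bound for $(f,\mathcal{S})$ with gain $c\ge1$ and decay rate $\lambda\in(0,1)$ if for every $\theta^*\in\mathcal{S}$, $t_0\in\mathbb{Z}$, $\phi_0\in\mathbb{R}^{n_\phi}$, $z_{1_0}\in\mathbb{R}^{l_1}$, $z_{2_0}\in\mathcal{X}$, $w\in\mathbb{S}(\mathbb{R}^{d_y})$ and $r\in\mathbb{S}(\mathbb{R}^q)$, when the controller is applied to the time-invariant plant with parameter $\theta^*$, for all integers $t\ge\tau\ge t_0$: $$\left\|\begin{bmatrix} \phi(t) \\ z_1(t) \end{bmatrix}\right\|\le c\lambda^{t-\tau}\left\|\begin{bmatrix} \phi(\tau) \\ z_1(\tau) \end{bmatrix}\right\|+\sum_{j=\tau}^{t-1}c\lambda^{t-j-1}(\|r(j)\|+\|w(j)\|)+c\|r(t)\|.$$ Time-variation class. For $c_0\ge0$, $\epsilon>0$, $s(\mathcal{S},c_0,\epsilon)$ is the set of $\theta^*\in\boldsymbol\ell_\infty(\mathbb{R}^{p\times d_y})$ such that $\theta^*(t)\in\mathcal{S}$ for all $t\in\mathbb{Z}$ and $\sum_{t=t_1}^{t_2-1}\|\theta^*(t+1)-\theta^*(t)\|\le c_0+\epsilon(t_2-t_1)$ for all integers $t_2>t_1$. Convolution bound for $(f,s(\mathcal{S},c_0,\epsilon))$. The controller provides a convolution bound for $(f,s(\mathcal{S},c_0,\epsilon))$ with gain $c\ge1$ and decay rate $\lambda\in(0,1)$ if for every $\theta^*\in s(\mathcal{S},c_0,\epsilon)$, $t_0\in\mathbb{Z}$,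 $\phi_0\in\mathbb{R}^{n_\phi}$, $z_{1_0}\in\mathbb{R}^{l_1}$, $z_{2_0}\in\mathcal{X}$, $w\in\mathbb{S}(\mathbb{R}^{d_y})$ and $r\in\mathbb{S}(\mathbb{R}^q)$, when the controller is applied to the time-varying plant with parameter sequence $\theta^*(\cdot)$, for all integers $t\ge\tau\ge t_0$: $$\left\|\begin{bmatrix} \phi(t) \\ z_1(t) \end{bmatrix}\right\|\le c\lambda^{t-\tau}\left\|\begin{bmatrix} \phi(\tau) \\ z_1(\tau) \end{bmatrix}\right\|+\sum_{j=\tau}^{t-1}c\lambda^{t-j-1}(\|r(j)\|+\|w(j)\|)+c\|r(t)\|.$$ *)

theory Defs
  imports "HOL-Analysis.L2_Norm" "Jordan_Normal_Form.Matrix"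
begin

text \<open>Vectors and matrices are those of Jordan_Normal_Form, with dimensions given by explicit
  carriers, because the controller states and the exogenous signal may have dimension zero and
  the regressor dimension is \<open>n\<^sub>y d\<^sub>y + n\<^sub>u d\<^sub>u\<close>.\<close>

definition vnorm :: "real vec \<Rightarrow> real" where
  "vnorm v = L2_set (\<lambda>i. v $ i) {..<dim_vec v}"

text \<open>The induced norm is a supremum over the closed unit ball rather than the unit sphere, so
  that the supremum is over a nonempty set also for a matrix without columns.\<close>

definition mnorm :: "real mat \<Rightarrow> real" where
  "mnorm A = Sup {vnorm (A *\<^sub>v v) | v. v \<in> carrier_vec (dim_col A) \<and> vnorm v \<le> 1}"

definition bounded_mats :: "real mat set \<Rightarrow> bool" where
  "bounded_mats S \<longleftrightarrow> (\<exists>B. \<forall>A\<in>S. mnorm A \<le> B)"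

definition bounded_gain :: "nat \<Rightarrow> (real vec \<Rightarrow> real vec) \<Rightarrow> bool" where
  "bounded_gain a \<Gamma> \<longleftrightarrow> (\<exists>\<nu>>0. \<forall>x\<in>carrier_vec a. vnorm (\<Gamma> x) \<le> \<nu> * vnorm x)"

definition signals :: "nat \<Rightarrow> (int \<Rightarrow> real vec) set" where
  "signals k = {s. \<forall>t. s t \<in> carrier_vec k}"

definition bounded_mat_seqs :: "nat \<Rightarrow> nat \<Rightarrow> (int \<Rightarrow> real mat) set" where
  "bounded_mat_seqs m n =
     {\<theta>. (\<forall>t. \<theta> t \<in> carrier_mat m n) \<and> (\<exists>B. \<forall>t. mnorm (\<theta> t) \<le> B)}"

record dims =
  d_y :: nat
  d_u :: nat
  d_p :: nat
  n_y :: nat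
  n_u :: nat
  l_1 :: nat
  l_2 :: nat
  d_r :: nat

definition n_phi :: "dims \<Rightarrow> nat" where
  "n_phi D = n_y D * d_y D + n_u D * d_u D"

definition regressor :: "dims \<Rightarrow> (int \<Rightarrow> real vec) \<Rightarrow> (int \<Rightarrow> real vec) \<Rightarrow> int \<Rightarrow> real vec" where
  "regressor D y u t =
     foldr (@\<^sub>v) (map (\<lambda>i. y (t - int i)) [0..<n_y D] @ map (\<lambda>i. u (t - int i)) [0..<n_u D]) vNil"

record controller =
  ctrl_g1 :: "real vec \<Rightarrow> real vec \<Rightarrow> real vec \<Rightarrow> real vec \<Rightarrow> real vec \<Rightarrow> int \<Rightarrow> int \<Rightarrow> real vec"
  ctrl_g2 :: "real vec \<Rightarrow> real vec \<Rightarrow> real vec \<Rightarrow> real vec \<Rightarrow> real vec \<Rightarrow> int \<Rightarrow> int \<Rightarrow> real vec"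
  ctrl_h :: "real vec \<Rightarrow> real vec \<Rightarrow> real vec \<Rightarrow> real vec \<Rightarrow> real vec"
  ctrl_X :: "real vec set"

text \<open>The domains and codomains of \<open>g\<^sub>1\<close>, \<open>g\<^sub>2\<close>, \<open>h\<close>; the values of these (total) functions
  outside their domains are irrelevant.\<close>

definition is_controller :: "dims \<Rightarrow> controller \<Rightarrow> bool" where
  "is_controller D C \<longleftrightarrow>
     ctrl_X C \<subseteq> carrier_vec (l_2 D) \<and>
     (\<forall>z1\<in>carrier_vec (l_1 D). \<forall>z2\<in>ctrl_X C. \<forall>\<phi>\<in>carrier_vec (n_phi D). \<forall>r\<in>carrier_vec (d_r D).
        ctrl_h C z1 z2 \<phi> r \<in> carrier_vec (d_u D) \<and>
        (\<forall>y\<in>carrier_vec (d_y D). \<forall>t t0.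
           ctrl_g1 C z1 z2 \<phi> y r t t0 \<in> carrier_vec (l_1 D) \<and>
           ctrl_g2 C z1 z2 \<phi> y r t t0 \<in> ctrl_X C))"

definition tv_plant ::
  "dims \<Rightarrow> (real vec \<Rightarrow> real vec) \<Rightarrow> (int \<Rightarrow> real mat) \<Rightarrow> int \<Rightarrow> real vec \<Rightarrow> (int \<Rightarrow> real vec)
     \<Rightarrow> (int \<Rightarrow> real vec) \<Rightarrow> (int \<Rightarrow> real vec) \<Rightarrow> bool" where
  "tv_plant D f \<theta> t0 \<phi>0 w y u \<longleftrightarrow>
     regressor D y u t0 = \<phi>0 \<and>
     (\<forall>t\<ge>t0. y (t + 1) = transpose_mat (\<theta> t) *\<^sub>v f (regressor D y u t) + w t)"

definition ti_plant ::
  "dims \<Rightarrow> (real vec \<Rightarrow> real vec) \<Rightarrow> real mat \<Rightarrow> int \<Rightarrow> real vec \<Rightarrow> (int \<Rightarrow> real vec)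
     \<Rightarrow> (int \<Rightarrow> real vec) \<Rightarrow> (int \<Rightarrow> real vec) \<Rightarrow> bool" where
  "ti_plant D f \<theta> t0 \<phi>0 w y u \<longleftrightarrow>
     regressor D y u t0 = \<phi>0 \<and>
     (\<forall>t\<ge>t0. y (t + 1) = transpose_mat \<theta> *\<^sub>v f (regressor D y u t) + w t)"

definition control_law ::
  "dims \<Rightarrow> controller \<Rightarrow> int \<Rightarrow> real vec \<Rightarrow> real vec \<Rightarrow> (int \<Rightarrow> real vec)
     \<Rightarrow> (int \<Rightarrow> real vec) \<Rightarrow> (int \<Rightarrow> real vec) \<Rightarrow> (int \<Rightarrow> real vec) \<Rightarrow> (int \<Rightarrow> real vec) \<Rightarrow> bool" where
  "control_law D C t0 z10 z20 r y u z1 z2 \<longleftrightarrow>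
     z1 t0 = z10 \<and> z2 t0 = z20 \<and>
     (\<forall>t\<ge>t0.
        z1 (t + 1) = ctrl_g1 C (z1 t) (z2 t) (regressor D y u t) (y (t + 1)) (r t) t t0 \<and>
        z2 (t + 1) = ctrl_g2 C (z1 t) (z2 t) (regressor D y u t) (y (t + 1)) (r t) t t0 \<and>
        u t = ctrl_h C (z1 t) (z2 t) (regressor D y u t) (r t))"

definition convolution_ineq ::
  "dims \<Rightarrow> real \<Rightarrow> real \<Rightarrow> int \<Rightarrow> (int \<Rightarrow> real vec) \<Rightarrow> (int \<Rightarrow> real vec)
     \<Rightarrow> (int \<Rightarrow> real vec) \<Rightarrow> (int \<Rightarrow> real vec) \<Rightarrow> (int \<Rightarrow> real vec) \<Rightarrow> bool" where
  "convolution_ineq D c lam t0 w r y u z1 \<longleftrightarrow>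
     (\<forall>\<tau> t. t0 \<le> \<tau> \<and> \<tau> \<le> t \<longrightarrow>
        vnorm (regressor D y u t @\<^sub>v z1 t)
          \<le> c * lam powi (t - \<tau>) * vnorm (regressor D y u \<tau> @\<^sub>v z1 \<tau>)
            + (\<Sum>j\<in>{\<tau>..<t}. c * lam powi (t - j - 1) * (vnorm (r j) + vnorm (w j)))
            + c * vnorm (r t))"

text \<open>The closed loop is a relation on trajectories: the regressor at time \<open>t\<close> contains \<open>u t\<close>, so
  the control law is an implicit equation for \<open>u t\<close>, and the bound is required of every trajectory
  that satisfies the plant and controller equations. The values of \<open>y\<close> and \<open>u\<close> before the
  window of the initial regressor, and of \<open>z1\<close> and \<open>z2\<close> before \<open>t0\<close>, play no role.\<close>

definition convolution_bound_ti ::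
  "dims \<Rightarrow> controller \<Rightarrow> (real vec \<Rightarrow> real vec) \<Rightarrow> real mat set \<Rightarrow> real \<Rightarrow> real \<Rightarrow> bool" where
  "convolution_bound_ti D C f S c lam \<longleftrightarrow>
     1 \<le> c \<and> 0 < lam \<and> lam < 1 \<and>
     (\<forall>\<theta>\<in>S. \<forall>t0. \<forall>\<phi>0\<in>carrier_vec (n_phi D). \<forall>z10\<in>carrier_vec (l_1 D). \<forall>z20\<in>ctrl_X C.
      \<forall>w\<in>signals (d_y D). \<forall>r\<in>signals (d_r D). \<forall>y\<in>signals (d_y D). \<forall>u\<in>signals (d_u D). \<forall>z1 z2.
        ti_plant D f \<theta> t0 \<phi>0 w y u \<and> control_law D C t0 z10 z20 r y u z1 z2 \<longrightarrow>
        convolution_ineq D c lam t0 w r y u z1)"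

definition convolution_bound_tv ::
  "dims \<Rightarrow> controller \<Rightarrow> (real vec \<Rightarrow> real vec) \<Rightarrow> (int \<Rightarrow> real mat) set \<Rightarrow> real \<Rightarrow> real \<Rightarrow> bool" where
  "convolution_bound_tv D C f \<Theta> c lam \<longleftrightarrow>
     1 \<le> c \<and> 0 < lam \<and> lam < 1 \<and>
     (\<forall>\<theta>\<in>\<Theta>. \<forall>t0. \<forall>\<phi>0\<in>carrier_vec (n_phi D). \<forall>z10\<in>carrier_vec (l_1 D). \<forall>z20\<in>ctrl_X C.
      \<forall>w\<in>signals (d_y D). \<forall>r\<in>signals (d_r D). \<forall>y\<in>signals (d_y D). \<forall>u\<in>signals (d_u D). \<forall>z1 z2.
        tv_plant D f \<theta> t0 \<phi>0 w y u \<and> control_law D C t0 z10 z20 r y u z1 z2 \<longrightarrow>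
        convolution_ineq D c lam t0 w r y u z1)"

definition time_variation_class ::
  "nat \<Rightarrow> nat \<Rightarrow> real mat set \<Rightarrow> real \<Rightarrow> real \<Rightarrow> (int \<Rightarrow> real mat) set" where
  "time_variation_class m n S c0 \<epsilon> =
     {\<theta> \<in> bounded_mat_seqs m n.
        (\<forall>t. \<theta> t \<in> S) \<and>
        (\<forall>t1 t2. t1 < t2 \<longrightarrow>
           (\<Sum>t\<in>{t1..<t2}. mnorm (\<theta> (t + 1) - \<theta> t)) \<le> c0 + \<epsilon> * of_int (t2 - t1))}"

end

theory Submission
  imports Defs
begin

text \<open>A closed-loop trajectory of the time-varying plant is also a trajectory of the time-invariant
  plant with frozen parameter \<open>\<theta> k\<close>, started at the same \<open>t0\<close>, if the disturbance is changed to
  \<open>w t + (\<theta> t - \<theta> k)\<^sup>T f (\<phi> t)\<close>. So for each frozen time the assumed bound holds with an additional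
  term of size \<open>\<nu> (W t - W k) \<parallel>\<phi> t\<parallel>\<close>, where \<open>W\<close> is the accumulated variation of the parameter. On
  a window of length \<open>N\<close>, freezing at its beginning, a discrete Gronwall argument bounds the effect by
  a factor \<open>exp (K * (variation over the window))\<close>. Choosing \<open>N\<close> with \<open>c * lam ^ N \<le> sqrt lam ^ N\<close>
  absorbs the constant \<open>c\<close> over each full window. When windows are chained, the exponential factors
  multiply to \<open>exp (K * (total variation)) \<le> exp (K * c0) * exp (K * \<epsilon>) ^ t\<close>, and \<open>\<epsilon>\<close> only has to
  satisfy \<open>sqrt lam * exp (K * \<epsilon>) < 1\<close>, which does not involve \<open>c0\<close>.\<close>

section \<open>Scalar convolution inequalities\<close>

text \<open>The zero-state response of the scalar recursion
  \<open>s (Suc n) = q * s n + g n\<close>. Natural-number time allows induction over the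
  steps.\<close>

definition conv :: "real \<Rightarrow> (nat \<Rightarrow> real) \<Rightarrow> nat \<Rightarrow> real" where
  "conv q g n = (\<Sum>i<n. q ^ (n - Suc i) * g i)"

section \<open>Algebra and monotonicity of convolution with a geometric kernel\<close>

lemma conv_0 [simp]: "conv q g 0 = 0"
  by (simp add: conv_def)

lemma conv_Suc: "conv q g (Suc n) = q * conv q g n + g n"
proof -
  have "q ^ (n - i) * g i = q * (q ^ (n - Suc i) * g i)" if "i < n" for i
  proof -
    have "n - i = Suc (n - Suc i)" using that by simp
    then show ?thesis by simp
  qed
  then have "(\<Sum>i<n. q ^ (n - i) * g i) = (\<Sum>i<n. q * (q ^ (n - Suc i) * g i))"
    by (intro sum.cong) auto
  then show ?thesis
    by (simp add: conv_def sum_distrib_left)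
qed

text \<open>The response accumulated up to \<open>m\<close> acts as an initial state for the
  remaining \<open>n\<close> steps. This is what joins consecutive windows.\<close>

lemma conv_add: "conv q g (m + n) = q ^ n * conv q g m + conv q (\<lambda>i. g (m + i)) n"
  by (induction n) (simp_all add: conv_Suc algebra_simps)

lemma conv_mult_left: "conv q (\<lambda>i. a * g i) n = a * conv q g n"
  by (simp add: conv_def sum_distrib_left mult_ac)

lemma conv_mono:
  assumes "0 \<le> p" "p \<le> q" "\<And>i. i < n \<Longrightarrow> 0 \<le> g i" "\<And>i. i < n \<Longrightarrow> g i \<le> h i"
  shows "conv p g n \<le> conv q h n"
  unfolding conv_def using assms by (intro sum_mono mult_mono power_mono) auto

lemma conv_nonneg:
  assumes "0 \<le> q" "\<And>i. i < n \<Longrightarrow> 0 \<le> g i"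
  shows "0 \<le> conv q g n"
  unfolding conv_def using assms by (intro sum_nonneg mult_nonneg_nonneg) auto

text \<open>Serves to absorb a direct term at the beginning of a window into the convolution over
  that window.\<close>

lemma conv_ge_first:
  assumes "0 \<le> q" "\<And>i. i < n \<Longrightarrow> 0 \<le> g i" "0 < n"
  shows "q ^ (n - 1) * g 0 \<le> conv q g n"
proof -
  have "q ^ (n - Suc 0) * g 0 \<le> (\<Sum>i<n. q ^ (n - Suc i) * g i)"
    by (rule member_le_sum[of 0 "{..<n}" "\<lambda>i. q ^ (n - Suc i) * g i"]) (use assms in auto)
  then show ?thesis by (simp add: conv_def)
qed

text \<open>The bracket on the right of the bound satisfies a linear recursion. Inserting the bound
  on \<open>x\<close> into it multiplies each step by at most \<open>exp (k * d)\<close>, with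
  \<open>k = c * nu / lam\<close> and \<open>d\<close> the variation since \<open>a\<close>. As
  \<open>d\<close> is nondecreasing, the \<open>n\<close> factors are all at most the last one,
  which gives the factor \<open>real n\<close> in the exponent.\<close>

lemma window_gronwall:
  fixes x b rho W :: "nat \<Rightarrow> real"
  assumes c: "1 \<le> c" and lam: "0 < lam" "lam \<le> 1" and nu: "0 \<le> nu"
    and x: "\<And>n. 0 \<le> x n" and rho: "\<And>n. 0 \<le> rho n" and b: "\<And>n. rho n \<le> b n"
    and W: "mono W"
    and bound: "\<And>n. x (a + n) \<le> c * (lam ^ n * x a
        + conv lam (\<lambda>i. b (a + i) + nu * (W (a + i) - W a) * x (a + i)) n) + c * rho (a + n)"
  shows "x (a + n) \<le> c * (exp (real n * (c * nu / lam) * (W (a + n) - W a))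
        * (lam ^ n * x a + conv lam (\<lambda>i. b (a + i)) n)) + c * rho (a + n)"
proof -
  \<comment> \<open>Chosen so that \<open>c * nu = lam * k\<close>, which lets \<open>lam\<close> be
    factored out of the decaying term.\<close>
  define k where "k = c * nu / lam"
  define s where "s n = lam ^ n * x a
      + conv lam (\<lambda>i. b (a + i) + nu * (W (a + i) - W a) * x (a + i)) n" for n
  define d where "d n = W (a + n) - W a" for n
  define B where "B n = lam ^ n * x a + conv lam (\<lambda>i. b (a + i)) n" for n
  have b0: "0 \<le> b n" for n using b rho order_trans by blast
  have k0: "0 \<le> k" using c nu lam by (simp add: k_def)
  have d0: "0 \<le> d n" for n using monoD[OF W, of a "a + n"] by (simp add: d_def)
  have dm: "d n \<le> d (Suc n)" for n using monoD[OF W, of "a + n" "a + Suc n"] by (simp add: d_def)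
  have B0: "0 \<le> B n" for n
    unfolding B_def using x b0 lam by (intro add_nonneg_nonneg mult_nonneg_nonneg conv_nonneg) auto
  have s0: "0 \<le> s n" for n
    unfolding s_def using x b0 lam nu d0[unfolded d_def]
    by (intro add_nonneg_nonneg mult_nonneg_nonneg conv_nonneg) auto
  have "s n \<le> exp (real n * k * d n) * B n"
  proof (induction n)
    case 0
    show ?case by (simp add: s_def B_def)
  next
    case (Suc n)
    have "x (a + n) \<le> c * s n + c * rho (a + n)"
      using bound[of n] by (simp add: s_def)
    \<comment> \<open>The direct term is charged to the input, so that the recursion involves only
      \<open>s\<close> and \<open>b\<close>.\<close>
    also have "\<dots> \<le> c * s n + c * b (a + n)" using b c by simp
    finally have xs: "x (a + n) \<le> c * s n + c * b (a + n)" .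
    have e: "1 + k * d n \<le> exp (k * d n)" by (rule exp_ge_add_one_self)
    have ck: "c * nu = lam * k" using lam by (simp add: k_def)
    have kd: "0 \<le> k * d n" using k0 d0 by simp
    have "s (Suc n) = lam * s n + b (a + n) + nu * d n * x (a + n)"
      by (simp add: s_def conv_Suc d_def algebra_simps)
    also have "\<dots> \<le> lam * s n + b (a + n) + nu * d n * (c * s n + c * b (a + n))"
      using mult_left_mono[OF xs, of "nu * d n"] nu d0 by simp
    also have "\<dots> = lam * (1 + k * d n) * s n + (1 + lam * (k * d n)) * b (a + n)"
    proof -
      have "nu * d n * (c * s n + c * b (a + n)) = (c * nu) * (d n * (s n + b (a + n)))"
        by (simp add: algebra_simps)
      then show ?thesis unfolding ck by (simp add: algebra_simps)
    qed
    also have "\<dots> \<le> lam * exp (k * d n) * s n + exp (k * d n) * b (a + n)"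
    proof (intro add_mono mult_right_mono mult_left_mono e s0 b0)
      have "lam * (k * d n) \<le> k * d n" using kd lam by (simp add: mult_left_le_one_le)
      then show "1 + lam * (k * d n) \<le> exp (k * d n)" using e by linarith
    qed (use lam in simp)
    \<comment> \<open>The newest input carries a single exponential factor but is given
      \<open>Suc n\<close> of them, to share a common factor with the older terms.\<close>
    also have "\<dots> \<le> lam * exp (k * d n) * (exp (real n * k * d n) * B n)
        + exp (real (Suc n) * k * d n) * b (a + n)"
    proof (intro add_mono mult_right_mono mult_left_mono Suc b0)
      have "1 * (k * d n) \<le> real (Suc n) * (k * d n)" using kd by (intro mult_right_mono) auto
      then show "exp (k * d n) \<le> exp (real (Suc n) * k * d n)" by (simp add: mult.assoc)
    qed (use lam in simp)
    also have "\<dots> = exp (real (Suc n) * k * d n) * B (Suc n)"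
      by (simp add: B_def conv_Suc algebra_simps exp_add)
    also have "\<dots> \<le> exp (real (Suc n) * k * d (Suc n)) * B (Suc n)"
      using dm[of n] k0 by (intro mult_right_mono B0) (auto intro!: mult_left_mono)
    finally show ?case .
  qed
  then have "c * s n \<le> c * (exp (real n * k * d n) * B n)" using c by simp
  then show ?thesis using bound[of n] by (simp add: s_def k_def d_def B_def)
qed

text \<open>Subtracting \<open>c * rho\<close> from \<open>x\<close> keeps the direct terms \<open>c * rho\<close> at the window ends from
  accumulating. The weight \<open>W (a + i - N)\<close> (truncated subtraction) is a lower bound for the value of
  \<open>W\<close> at the beginning of the window that contains \<open>a + i\<close>.\<close>

lemma chained_windows:
  fixes x b rho W :: "nat \<Rightarrow> real"
  assumes c: "1 \<le> c" and lam: "0 < lam" "lam \<le> mu" "mu \<le> 1" and nu: "0 \<le> nu"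
    and N: "0 < N" "c * lam ^ N \<le> mu ^ N" and K: "K = real N * (c * nu / lam)"
    and x: "\<And>n. 0 \<le> x n" and rho: "\<And>n. 0 \<le> rho n" and b: "\<And>n. rho n \<le> b n"
    and W: "mono W"
    and bound: "\<And>a n. x (a + n) \<le> c * (lam ^ n * x a
        + conv lam (\<lambda>i. b (a + i) + nu * (W (a + i) - W a) * x (a + i)) n) + c * rho (a + n)"
  defines "X \<equiv> \<lambda>n. max 0 (x n - c * rho n)"
  shows "X (a + n) \<le> c * exp (K * (W (a + n) - W a)) * mu ^ n * X a
        + 2 * c ^ 3 * conv mu (\<lambda>i. exp (K * (W (a + n) - W (a + i - N))) * b (a + i)) n"
proof -
  have b0: "0 \<le> b n" for n using b rho order_trans by blast
  have X0: "0 \<le> X n" for n by (simp add: X_def)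
  have K0: "0 \<le> K" using K c nu lam by simp
  have Wm: "i \<le> j \<Longrightarrow> W i \<le> W j" for i j using monoD[OF W] .
  have c23: "c ^ 2 \<le> c ^ 3"
    using c by (simp add: power2_eq_square power3_eq_cube)
  \<comment> \<open>Here \<open>c * lam ^ n\<close> is kept unsimplified: for \<open>n = N\<close>
    it is at most \<open>mu ^ N\<close>, so a full window multiplies the initial value by no extra
    constant.\<close>
  have window: "X (a + n) \<le> exp (K * (W (a + n) - W a)) * (c * lam ^ n * X a)
      + 2 * c ^ 2 * conv mu (\<lambda>i. exp (K * (W (a + n) - W (a + i - N))) * b (a + i)) n"
    if n: "n \<le> N" for a n
  proof (cases "n = 0")
    case True
    have "1 * X a \<le> c * X a" using c X0 by (intro mult_right_mono) auto
    then show ?thesis using True by simp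
  next
    case False
    define e where "e = exp (K * (W (a + n) - W a))"
    let ?cb = "conv lam (\<lambda>i. b (a + i)) n"
    let ?w = "\<lambda>i. exp (K * (W (a + n) - W (a + i - N))) * b (a + i)"
    have cb0: "0 \<le> ?cb" using lam b0 by (intro conv_nonneg) auto
    have "real n * (c * nu / lam) \<le> K"
      unfolding K using n c nu lam by (intro mult_right_mono) auto
    then have e: "exp (real n * (c * nu / lam) * (W (a + n) - W a)) \<le> e"
      unfolding e_def using Wm[of a "a + n"] by (subst exp_le_cancel_iff, intro mult_right_mono) auto
    \<comment> \<open>Replacing \<open>x a\<close> by \<open>X a\<close> costs
      \<open>c * rho a\<close>. After decay, \<open>rho a\<close> is dominated by the first
      convolution term, hence the factor \<open>1 + c\<close>, at most \<open>2 * c\<close>.\<close>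
    have "x a \<le> X a + c * rho a" by (simp add: X_def)
    then have "lam ^ n * x a \<le> lam ^ n * X a + c * (lam ^ n * rho a)"
      using lam mult_left_mono[of "x a" "X a + c * rho a" "lam ^ n"] by (simp add: algebra_simps)
    moreover have "lam ^ n * rho a \<le> ?cb"
    proof -
      have "lam ^ n * rho a \<le> lam ^ (n - 1) * b (a + 0)"
        using lam rho b by (intro mult_mono power_decreasing) auto
      also have "\<dots> \<le> ?cb"
        using lam b0 False by (intro conv_ge_first[of lam n "\<lambda>i. b (a + i)"]) auto
      finally show ?thesis .
    qed
    then have "c * (lam ^ n * rho a) \<le> c * ?cb" using c by simp
    moreover have "?cb \<le> c * ?cb" using mult_right_mono[OF c cb0] by simp
    ultimately have *: "lam ^ n * x a + ?cb \<le> lam ^ n * X a + 2 * c * ?cb" by simp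
    have nn: "0 \<le> lam ^ n * x a + ?cb" using lam x cb0 by simp
    have "x (a + n) \<le> c * (exp (real n * (c * nu / lam) * (W (a + n) - W a))
        * (lam ^ n * x a + ?cb)) + c * rho (a + n)"
      by (rule window_gronwall) (use c lam nu x rho b W bound in auto)
    moreover have "c * (exp (real n * (c * nu / lam) * (W (a + n) - W a)) * (lam ^ n * x a + ?cb))
        \<le> c * (e * (lam ^ n * X a + 2 * c * ?cb))"
      using c e * nn by (intro mult_left_mono mult_mono) (auto simp: e_def)
    \<comment> \<open>\<open>X\<close> is a maximum with \<open>0\<close>, so the upper bound has to
      be nonnegative as well.\<close>
    moreover have "0 \<le> c * (e * (lam ^ n * X a + 2 * c * ?cb))"
      using c cb0 X0 lam by (simp add: e_def)
    ultimately have "X (a + n) \<le> c * (e * (lam ^ n * X a + 2 * c * ?cb))"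
      by (simp add: X_def)
    also have "\<dots> = e * (c * lam ^ n * X a) + 2 * c ^ 2 * conv lam (\<lambda>i. e * b (a + i)) n"
      by (simp add: conv_mult_left algebra_simps power2_eq_square)
    also have "\<dots> \<le> e * (c * lam ^ n * X a) + 2 * c ^ 2 * conv mu ?w n"
    proof (intro add_left_mono mult_left_mono conv_mono mult_right_mono b0)
      fix i assume "i < n"
      then have "W (a + i - N) \<le> W a" using n by (intro Wm) auto
      then show "e \<le> exp (K * (W (a + n) - W (a + i - N)))"
        unfolding e_def using K0 by (simp add: mult_left_mono)
    qed (use lam b0 in \<open>auto simp: e_def\<close>)
    finally show ?thesis by (simp add: e_def)
  qed
  show ?thesis
  proof (induction n arbitrary: a rule: less_induct)
    case (less n)
    let ?w = "\<lambda>n i. exp (K * (W (a + n) - W (a + i - N))) * b (a + i)"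
    have w0: "0 \<le> conv mu (?w j) n" for j n
      using lam b0 by (intro conv_nonneg) auto
    show ?case
    proof (cases "n \<le> N")
      case True
      have "exp (K * (W (a + n) - W a)) * (c * lam ^ n * X a)
          \<le> exp (K * (W (a + n) - W a)) * (c * mu ^ n * X a)"
        using c lam X0 by (intro mult_mono power_mono) auto
      moreover have "2 * c ^ 2 * conv mu (?w n) n \<le> 2 * c ^ 3 * conv mu (?w n) n"
        using c c23 w0 by (intro mult_mono) auto
      ultimately show ?thesis using window[OF True, of a] by (simp add: mult_ac)
    next
      case False
      \<comment> \<open>The first full window is peeled off and the induction hypothesis is applied
        from \<open>a + N\<close>. Its factor \<open>c\<close> meets \<open>mu ^ N\<close> with no
        further \<open>c\<close>, so the gain on the initial value does not grow with the number of
        windows; on the inputs of the first window it turns \<open>2 * c ^ 2\<close> into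
        \<open>2 * c ^ 3\<close>.\<close>
      define m where "m = n - N"
      have m: "m < n" "n = N + m" using False N by (auto simp: m_def)
      let ?E = "exp (K * (W (a + n) - W (a + N)))"
      let ?F = "exp (K * (W (a + N) - W a))"
      have "X (a + N) \<le> ?F * (c * lam ^ N * X a) + 2 * c ^ 2 * conv mu (?w N) N"
        using window[of N a] by simp
      also have "\<dots> \<le> ?F * (mu ^ N * X a) + 2 * c ^ 2 * conv mu (?w N) N"
        using N X0 by (intro add_right_mono mult_left_mono mult_right_mono) auto
      finally have XN: "X (a + N) \<le> ?F * (mu ^ N * X a) + 2 * c ^ 2 * conv mu (?w N) N" .
      \<comment> \<open>The exponents telescope: multiplying by \<open>?E\<close> moves the end
        point of every weight from \<open>a + N\<close> to \<open>a + n\<close>.\<close>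
      have EF: "?E * ?F = exp (K * (W (a + n) - W a))"
        by (simp add: exp_add[symmetric] algebra_simps)
      have "?E * ?w N i = ?w n i" for i
        by (simp add: exp_add[symmetric] algebra_simps)
      then have Ew: "?E * conv mu (?w N) N = conv mu (?w n) N"
        by (simp only: conv_mult_left[symmetric])
      have "X (a + n) \<le> c * ?E * mu ^ m * X (a + N)
          + 2 * c ^ 3 * conv mu (\<lambda>i. ?w n (N + i)) m"
        using less[OF m(1), of "a + N"] by (simp add: m(2) add.assoc)
      also have "\<dots> \<le> c * ?E * mu ^ m * (?F * (mu ^ N * X a) + 2 * c ^ 2 * conv mu (?w N) N)
          + 2 * c ^ 3 * conv mu (\<lambda>i. ?w n (N + i)) m"
        using c lam by (intro add_right_mono mult_left_mono XN) auto
      also have "\<dots> = c * (?E * ?F) * (mu ^ N * mu ^ m) * X a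
          + 2 * c ^ 3 * (mu ^ m * (?E * conv mu (?w N) N) + conv mu (\<lambda>i. ?w n (N + i)) m)"
        by (simp add: algebra_simps power3_eq_cube power2_eq_square)
      also have "\<dots> = c * exp (K * (W (a + n) - W a)) * mu ^ n * X a + 2 * c ^ 3 * conv mu (?w n) n"
        unfolding EF Ew using conv_add[of mu "?w n" N m] by (simp add: m(2) power_add)
      finally show ?thesis .
    qed
  qed
qed

text \<open>The input \<open>d\<close> depends on the starting time \<open>a\<close> as well as on
  the offset, because the disturbance seen by a frozen plant depends on the freezing time.\<close>

definition has_convolution_bound ::
    "real \<Rightarrow> real \<Rightarrow> (nat \<Rightarrow> real) \<Rightarrow> (nat \<Rightarrow> nat \<Rightarrow> real) \<Rightarrow> (nat \<Rightarrow> real) \<Rightarrow> bool" where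
  "has_convolution_bound c q x d rho \<longleftrightarrow>
     (\<forall>a n. x (a + n) \<le> c * (q ^ n * x a + conv q (d a) n) + c * rho (a + n))"

text \<open>The theorem reduced to scalars: \<open>x\<close> stands for the norm of the state,
  \<open>b\<close> for the size of the inputs, \<open>rho\<close> for the direct term and
  \<open>W\<close> for the accumulated variation. These are quantified after \<open>lam'\<close> and
  \<open>\<gamma>\<close>, so the constants are uniform over trajectories.\<close>

lemma convolution_bound_slow_drift:
  fixes c lam nu :: real
  assumes c: "1 \<le> c" and lam: "0 < lam" "lam < 1" and nu: "0 < nu"
  shows "\<exists>\<epsilon>>0. \<forall>c0\<ge>0. \<exists>lam' \<gamma>. 0 < lam' \<and> lam' < 1 \<and> 1 \<le> \<gamma> \<and>
    (\<forall>x b rho W. (\<forall>n. 0 \<le> x n \<and> 0 \<le> rho n \<and> rho n \<le> b n) \<longrightarrow> mono W \<longrightarrow>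
      (\<forall>i n. W (i + n) - W i \<le> c0 + \<epsilon> * real n) \<longrightarrow>
      has_convolution_bound c lam x (\<lambda>a i. b (a + i) + nu * (W (a + i) - W a) * x (a + i)) rho \<longrightarrow>
      has_convolution_bound \<gamma> lam' x (\<lambda>a i. b (a + i)) rho)"
proof -
  \<comment> \<open>Splits the decay in two: in \<open>lam ^ N = mu ^ N * mu ^ N\<close> one factor
    pays for \<open>c\<close> and the other remains as decay.\<close>
  define mu where "mu = sqrt lam"
  have mu: "0 < mu" "mu < 1" "mu * mu = lam"
    using lam by (auto simp: mu_def)
  have lm: "lam \<le> mu" using mu mult_right_mono[of mu 1 mu] by simp
  have "\<exists>n. mu ^ n < 1 / c" using mu c by (intro real_arch_pow_inv) auto
  then obtain N0 where N0: "mu ^ N0 < 1 / c" by blast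
  define N where "N = Suc N0"
  have "mu ^ N \<le> mu ^ N0" unfolding N_def using mu by (intro power_decreasing) auto
  with N0 have "mu ^ N \<le> 1 / c" by linarith
  then have "c * mu ^ N \<le> 1" using c by (simp add: field_simps)
  then have "(c * mu ^ N) * mu ^ N \<le> 1 * mu ^ N" using mu by (intro mult_right_mono) auto
  moreover have "lam ^ N = mu ^ N * mu ^ N" using mu(3) by (simp flip: power_mult_distrib)
  ultimately have N: "0 < N" "c * lam ^ N \<le> mu ^ N"
    by (auto simp: N_def mult.assoc)
  define K where "K = real N * (c * nu / lam)"
  have K0: "0 < K" using N c nu lam by (simp add: K_def)
  \<comment> \<open>With this value \<open>q\<close> is \<open>mu\<close> to the power
    \<open>-1/2\<close>, so that the final rate \<open>lam' = mu * q\<close> is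
    \<open>sqrt mu\<close>, the fourth root of \<open>lam\<close>.\<close>
  define \<epsilon> where "\<epsilon> = - ln mu / (2 * K)"
  have eps: "0 < \<epsilon>" using mu K0 by (simp add: \<epsilon>_def ln_less_zero divide_neg_pos)
  define q where "q = exp (K * \<epsilon>)"
  define lam' where "lam' = mu * q"
  have q: "1 \<le> q" using K0 eps by (simp add: q_def)
  have "mu * exp (- ln mu / 2) = exp (ln mu / 2)"
  proof -
    have "mu = exp (ln mu)" using mu by simp
    then have "mu * exp (- ln mu / 2) = exp (ln mu) * exp (- ln mu / 2)" by simp
    then show ?thesis by (simp flip: exp_add)
  qed
  then have l': "0 < lam'" "lam' < 1"
    using mu K0 by (auto simp: lam'_def q_def \<epsilon>_def)
  show ?thesis
  proof (rule exI[of _ \<epsilon>], intro conjI allI impI eps)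
    fix c0 :: real assume c0: "0 \<le> c0"
    \<comment> \<open>The exponential pays for \<open>c0\<close> and for the \<open>N\<close> steps
      by which the weights look back; \<open>q\<close> pays for one more step, since
      \<open>n - i = 1 + (n - Suc i)\<close>.\<close>
    define \<gamma> where "\<gamma> = 2 * c ^ 3 * exp (K * (c0 + \<epsilon> * real N)) * q"
    have e1: "1 \<le> exp (K * (c0 + \<epsilon> * real N))"
      using K0 c0 eps by simp
    have c3: "c \<le> c ^ 3" using c by (simp add: power3_eq_cube) (smt (verit) mult_le_cancel_left1 one_le_power)
    have "1 * 1 \<le> exp (K * (c0 + \<epsilon> * real N)) * q"
      using e1 q by (intro mult_mono) auto
    then have "c * 1 \<le> (2 * c ^ 3) * (exp (K * (c0 + \<epsilon> * real N)) * q)"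
      using c c3 by (intro mult_mono) auto
    then have g: "c \<le> \<gamma>" by (simp add: \<gamma>_def mult_ac)
    show "\<exists>lam' \<gamma>. 0 < lam' \<and> lam' < 1 \<and> 1 \<le> \<gamma> \<and>
      (\<forall>x b rho W. (\<forall>n. 0 \<le> x n \<and> 0 \<le> rho n \<and> rho n \<le> b n) \<longrightarrow> mono W \<longrightarrow>
      (\<forall>i n. W (i + n) - W i \<le> c0 + \<epsilon> * real n) \<longrightarrow>
      has_convolution_bound c lam x (\<lambda>a i. b (a + i) + nu * (W (a + i) - W a) * x (a + i)) rho \<longrightarrow>
      has_convolution_bound \<gamma> lam' x (\<lambda>a i. b (a + i)) rho)"
    proof (rule exI[of _ lam'], rule exI[of _ \<gamma>], intro conjI allI impI l')
      show "1 \<le> \<gamma>" using c g by simp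
    next
      fix x b rho W :: "nat \<Rightarrow> real"
      assume pos: "\<forall>n. 0 \<le> x n \<and> 0 \<le> rho n \<and> rho n \<le> b n"
        and W: "mono W" and Wb: "\<forall>i n. W (i + n) - W i \<le> c0 + \<epsilon> * real n"
        and bound: "has_convolution_bound c lam x
          (\<lambda>a i. b (a + i) + nu * (W (a + i) - W a) * x (a + i)) rho"
      from pos have x: "0 \<le> x n" and rho: "0 \<le> rho n" and b: "rho n \<le> b n" for n by auto
      show "has_convolution_bound \<gamma> lam' x (\<lambda>a i. b (a + i)) rho"
        unfolding has_convolution_bound_def
      proof (intro allI)
        fix a n
        have b0: "0 \<le> b n" for n using b rho order_trans by blast
        define X where "X = (\<lambda>n. max 0 (x n - c * rho n))"
        have qn: "exp (K * (\<epsilon> * real n)) = q ^ n" for n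
          by (simp add: q_def exp_of_nat_mult[symmetric] mult_ac)
        have X0: "0 \<le> X a" "X a \<le> x a" using x rho c by (auto simp: X_def)
        have g2: "c * exp (K * c0) \<le> \<gamma>"
        proof -
          have "c * exp (K * c0) \<le> (2 * c ^ 3) * exp (K * (c0 + \<epsilon> * real N))"
            using c c3 K0 eps by (intro mult_mono) auto
          also have "\<dots> \<le> \<gamma>" unfolding \<gamma>_def using q c mult_left_mono[of 1 q "2 * c ^ 3 * exp (K * (c0 + \<epsilon> * real N))"] by simp
          finally show ?thesis .
        qed
        have "X (a + n) \<le> c * exp (K * (W (a + n) - W a)) * mu ^ n * X a
            + 2 * c ^ 3 * conv mu (\<lambda>i. exp (K * (W (a + n) - W (a + i - N))) * b (a + i)) n"
          unfolding X_def
          by (rule chained_windows[of c lam mu nu N K x rho b W])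
            (use c lam lm mu nu N K_def x rho b W bound[unfolded has_convolution_bound_def] in auto)
        also have "c * exp (K * (W (a + n) - W a)) * mu ^ n * X a \<le> \<gamma> * (lam' ^ n * x a)"
        proof -
          have "exp (K * (W (a + n) - W a)) \<le> exp (K * (c0 + \<epsilon> * real n))"
            using Wb[rule_format, of a n] K0 by simp
          also have "\<dots> = exp (K * c0) * q ^ n" by (simp add: distrib_left exp_add qn)
          finally have "c * exp (K * (W (a + n) - W a)) * mu ^ n * X a
              \<le> c * (exp (K * c0) * q ^ n) * mu ^ n * x a"
            using c mu q X0 by (intro mult_mono) auto
          also have "\<dots> = c * exp (K * c0) * (lam' ^ n * x a)"
            by (simp add: lam'_def power_mult_distrib)
          also have "\<dots> \<le> \<gamma> * (lam' ^ n * x a)"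
            using l' x by (intro mult_right_mono g2) auto
          finally show ?thesis .
        qed
        also have "2 * c ^ 3 * conv mu (\<lambda>i. exp (K * (W (a + n) - W (a + i - N))) * b (a + i)) n
            \<le> \<gamma> * conv lam' (\<lambda>i. b (a + i)) n"
        proof -
          have "mu ^ (n - Suc i) * (exp (K * (W (a + n) - W (a + i - N))) * b (a + i))
              \<le> exp (K * (c0 + \<epsilon> * real N)) * q * (lam' ^ (n - Suc i) * b (a + i))"
            if "i < n" for i
          proof -
            have "W (a + n) - W (a + i - N) \<le> c0 + \<epsilon> * real (a + n - (a + i - N))"
              using Wb[rule_format, of "a + i - N" "a + n - (a + i - N)"] that by simp
            \<comment> \<open>When \<open>a + i - N\<close> is truncated at \<open>0\<close>, the
              interval only gets shorter, so the estimate still holds.\<close>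
            also have "\<dots> \<le> c0 + \<epsilon> * real (N + 1 + (n - Suc i))"
              using that eps by (intro add_left_mono mult_left_mono) auto
            finally have "exp (K * (W (a + n) - W (a + i - N)))
                \<le> exp (K * (c0 + \<epsilon> * real (N + 1 + (n - Suc i))))" using K0 by simp
            also have "K * (c0 + \<epsilon> * real (N + 1 + (n - Suc i)))
                = K * (c0 + \<epsilon> * real N) + K * (\<epsilon> * real 1) + K * (\<epsilon> * real (n - Suc i))"
              by (simp only: of_nat_add algebra_simps)
            also have "exp \<dots> = exp (K * (c0 + \<epsilon> * real N)) * q * q ^ (n - Suc i)"
              unfolding exp_add qn by simp
            finally have "mu ^ (n - Suc i) * (exp (K * (W (a + n) - W (a + i - N))) * b (a + i))
              \<le> mu ^ (n - Suc i) * (exp (K * (c0 + \<epsilon> * real N)) * q * q ^ (n - Suc i) * b (a + i))"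
              using mu b0 by (intro mult_left_mono mult_right_mono) auto
            then show ?thesis by (simp add: lam'_def power_mult_distrib mult_ac)
          qed
          then have "conv mu (\<lambda>i. exp (K * (W (a + n) - W (a + i - N))) * b (a + i)) n
              \<le> exp (K * (c0 + \<epsilon> * real N)) * q * conv lam' (\<lambda>i. b (a + i)) n"
            unfolding conv_def sum_distrib_left by (intro sum_mono) auto
          from mult_left_mono[OF this, of "2 * c ^ 3"] show ?thesis
            using c by (simp add: \<gamma>_def mult_ac)
        qed
        finally have "X (a + n) \<le> \<gamma> * (lam' ^ n * x a) + \<gamma> * conv lam' (\<lambda>i. b (a + i)) n" by simp
        moreover have "x (a + n) \<le> X (a + n) + c * rho (a + n)" by (simp add: X_def)
        moreover have "c * rho (a + n) \<le> \<gamma> * rho (a + n)" using g rho by (intro mult_right_mono) auto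
        ultimately show "x (a + n) \<le> \<gamma> * (lam' ^ n * x a + conv lam' (\<lambda>i. b (a + i)) n) + \<gamma> * rho (a + n)"
          by (simp add: distrib_left)
      qed
    qed
  qed
qed

section \<open>Vector and matrix norms\<close>

lemma vnorm_nonneg: "0 \<le> vnorm v"
  by (simp add: vnorm_def)

lemma vnorm_add:
  assumes "v \<in> carrier_vec n" "w \<in> carrier_vec n"
  shows "vnorm (v + w) \<le> vnorm v + vnorm w"
proof -
  have "vnorm (v + w) = L2_set (\<lambda>i. v $ i + w $ i) {..<n}"
    unfolding vnorm_def using assms by (intro L2_set_cong) auto
  also have "\<dots> \<le> vnorm v + vnorm w"
    using assms L2_set_triangle_ineq by (auto simp: vnorm_def carrier_vecD)
  finally show ?thesis .
qed

lemma vnorm_smult: "vnorm (a \<cdot>\<^sub>v v) = \<bar>a\<bar> * vnorm v"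
proof -
  have "vnorm (a \<cdot>\<^sub>v v) = L2_set (\<lambda>i. \<bar>a\<bar> * v $ i) {..<dim_vec v}"
    by (simp add: vnorm_def L2_set_def power_mult_distrib)
  then show ?thesis by (simp add: vnorm_def L2_set_right_distrib)
qed

lemma vnorm_zero [simp]: "vnorm (0\<^sub>v n) = 0"
  by (simp add: vnorm_def L2_set_eq_0_iff)

lemma vnorm_eq_0: "vnorm v = 0 \<Longrightarrow> v = 0\<^sub>v (dim_vec v)"
  by (auto simp: vnorm_def L2_set_eq_0_iff)

text \<open>Lets the gain bound on \<open>f\<close>, stated for the regressor, be expressed by the
  norm of the stacked state.\<close>

lemma vnorm_append_ge: "vnorm v \<le> vnorm (v @\<^sub>v w)"
proof -
  have "(\<Sum>i<dim_vec v. (v $ i)\<^sup>2) = (\<Sum>i<dim_vec v. ((v @\<^sub>v w) $ i)\<^sup>2)"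
    by (intro sum.cong) auto
  also have "\<dots> \<le> (\<Sum>i<dim_vec (v @\<^sub>v w). ((v @\<^sub>v w) $ i)\<^sup>2)"
    by (intro sum_mono2) auto
  finally show ?thesis
    by (simp add: vnorm_def L2_set_def)
qed

lemma vnorm_square: "(vnorm v)\<^sup>2 = v \<bullet> v"
  by (simp add: vnorm_def L2_set_def scalar_prod_def sum_nonneg power2_eq_square lessThan_atLeast0)

lemma scalar_prod_le_vnorm:
  assumes "v \<in> carrier_vec n" "w \<in> carrier_vec n"
  shows "v \<bullet> w \<le> vnorm v * vnorm w"
proof -
  have "v \<bullet> w \<le> (\<Sum>i<n. \<bar>v $ i\<bar> * \<bar>w $ i\<bar>)"
    using assms unfolding scalar_prod_def
    by (auto simp: lessThan_atLeast0 carrier_vecD simp flip: abs_mult intro!: sum_mono)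
  also have "\<dots> \<le> vnorm v * vnorm w"
    using L2_set_mult_ineq assms by (auto simp: vnorm_def carrier_vecD)
  finally show ?thesis .
qed

section \<open>The induced matrix norm\<close>

lemma vnorm_mult_mat_vec_bounded:
  "bdd_above {vnorm (A *\<^sub>v v) | v. v \<in> carrier_vec (dim_col A) \<and> vnorm v \<le> 1}"
proof (rule bdd_aboveI, safe)
  fix v assume v: "v \<in> carrier_vec (dim_col A)" "vnorm v \<le> 1"
  \<comment> \<open>Cauchy-Schwarz row by row. The resulting bound is uniform in \<open>v\<close>,
    which makes the real supremum in \<open>mnorm\<close> a genuine upper bound.\<close>
  have "\<bar>(A *\<^sub>v v) $ i\<bar> \<le> vnorm (row A i)" if i: "i < dim_row A" for i
  proof -
    have r: "row A i \<in> carrier_vec (dim_col A)" by simp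
    have "\<bar>row A i \<bullet> v\<bar> \<le> (\<Sum>j<dim_col A. \<bar>row A i $ j\<bar> * \<bar>v $ j\<bar>)"
      using v unfolding scalar_prod_def
      by (auto simp: lessThan_atLeast0 carrier_vecD simp flip: abs_mult intro!: sum_abs)
    also have "\<dots> \<le> vnorm (row A i) * vnorm v"
      using L2_set_mult_ineq v r by (auto simp: vnorm_def carrier_vecD)
    also have "\<dots> \<le> vnorm (row A i)"
      using v vnorm_nonneg by (simp add: mult_left_le)
    finally show ?thesis using i by simp
  qed
  then have "(\<Sum>i<dim_row A. \<bar>(A *\<^sub>v v) $ i\<bar>) \<le> (\<Sum>i<dim_row A. vnorm (row A i))"
    by (intro sum_mono) auto
  then show "vnorm (A *\<^sub>v v) \<le> (\<Sum>i<dim_row A. vnorm (row A i))"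
    using L2_set_le_sum_abs[of "\<lambda>i. (A *\<^sub>v v) $ i" "{..<dim_row A}"]
    unfolding vnorm_def dim_mult_mat_vec by (rule order_trans[rotated])
qed

lemma mnorm_upper:
  assumes "v \<in> carrier_vec (dim_col A)" "vnorm v \<le> 1"
  shows "vnorm (A *\<^sub>v v) \<le> mnorm A"
  unfolding mnorm_def using assms by (intro cSup_upper vnorm_mult_mat_vec_bounded) blast

lemma mnorm_nonneg: "0 \<le> mnorm A"
  using mnorm_upper[of "0\<^sub>v (dim_col A)" A] vnorm_nonneg[of "A *\<^sub>v 0\<^sub>v (dim_col A)"] by simp

lemma vnorm_mult_mat_vec_le:
  assumes A: "A \<in> carrier_mat m n" and v: "v \<in> carrier_vec n"
  shows "vnorm (A *\<^sub>v v) \<le> mnorm A * vnorm v"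
proof (cases "vnorm v = 0")
  case True
  then have "v = 0\<^sub>v n" using vnorm_eq_0[of v] carrier_vecD[OF v] by simp
  then have "A *\<^sub>v v = 0\<^sub>v m" using A by auto
  then show ?thesis using True by simp
next
  case False
  then have p: "0 < vnorm v" using vnorm_nonneg[of v] by linarith
  let ?u = "(1 / vnorm v) \<cdot>\<^sub>v v"
  have "vnorm (A *\<^sub>v ?u) \<le> mnorm A"
    using A v p by (intro mnorm_upper) (auto simp: vnorm_smult)
  also have "A *\<^sub>v ?u = (1 / vnorm v) \<cdot>\<^sub>v (A *\<^sub>v v)"
    using A v by (rule mult_mat_vec)
  finally show ?thesis using p by (simp add: vnorm_smult field_simps)
qed

text \<open>With \<open>x = A\<^sup>T v\<close> the bound follows from \<open>\<parallel>x\<parallel>\<^sup>2 = \<langle>v, A x\<rangle> \<le> \<parallel>v\<parallel> \<parallel>A\<parallel> \<parallel>x\<parallel>\<close>.\<close>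

lemma vnorm_mult_transpose_le:
  assumes A: "A \<in> carrier_mat m n" and v: "v \<in> carrier_vec m"
  shows "vnorm (transpose_mat A *\<^sub>v v) \<le> mnorm A * vnorm v"
proof -
  define x where "x = transpose_mat A *\<^sub>v v"
  have x: "x \<in> carrier_vec n" unfolding x_def using A v by (intro mult_mat_vec_carrier) auto
  have Ax: "A *\<^sub>v x \<in> carrier_vec m" by (rule mult_mat_vec_carrier[OF A x])
  have "(vnorm x)\<^sup>2 = (transpose_mat A *\<^sub>v v) \<bullet> x" by (simp add: vnorm_square x_def)
  also have "\<dots> = v \<bullet> (A *\<^sub>v x)" by (rule transpose_vec_mult_scalar[OF A x v])
  also have "\<dots> \<le> vnorm v * vnorm (A *\<^sub>v x)" by (rule scalar_prod_le_vnorm[OF v Ax])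
  also have "\<dots> \<le> vnorm v * (mnorm A * vnorm x)"
    by (intro mult_left_mono vnorm_mult_mat_vec_le[OF A x] vnorm_nonneg)
  finally have "vnorm x * vnorm x \<le> (mnorm A * vnorm v) * vnorm x"
    by (simp add: power2_eq_square mult_ac)
  then have "vnorm x \<le> mnorm A * vnorm v \<or> vnorm x = 0"
    using vnorm_nonneg[of x] by (auto simp: mult_le_cancel_right)
  moreover have "0 \<le> mnorm A * vnorm v" by (intro mult_nonneg_nonneg mnorm_nonneg vnorm_nonneg)
  ultimately show ?thesis by (auto simp: x_def[symmetric])
qed

lemma mnorm_add:
  assumes A: "A \<in> carrier_mat m n" and B: "B \<in> carrier_mat m n"
  shows "mnorm (A + B) \<le> mnorm A + mnorm B"
  unfolding mnorm_def[of "A + B"]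
proof (rule cSup_least, goal_cases)
  case 1
  \<comment> \<open>The zero vector shows that the set under the supremum is nonempty, even for a
    matrix without columns.\<close>
  have "0\<^sub>v (dim_col (A + B)) \<in> carrier_vec (dim_col (A + B)) \<and> vnorm (0\<^sub>v (dim_col (A + B))) \<le> 1"
    by simp
  then show ?case by blast
next
  case (2 y)
  then obtain v where v: "y = vnorm ((A + B) *\<^sub>v v)" "v \<in> carrier_vec n" "vnorm v \<le> 1"
    using B by auto
  have "(A + B) *\<^sub>v v = A *\<^sub>v v + B *\<^sub>v v"
    by (rule add_mult_distrib_mat_vec[OF A B v(2)])
  moreover have "A *\<^sub>v v \<in> carrier_vec m" "B *\<^sub>v v \<in> carrier_vec m" using A B v by auto
  ultimately have "y \<le> vnorm (A *\<^sub>v v) + vnorm (B *\<^sub>v v)"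
    unfolding v(1) using vnorm_add by simp
  also have "\<dots> \<le> mnorm A + mnorm B"
    using A B v by (intro add_mono mnorm_upper) auto
  finally show ?case .
qed

text \<open>Bounds the distance from a frozen parameter by the variation since freezing. The right
  side is a difference of prefix sums, matching \<open>W (a + i) - W a\<close> in the scalar
  part.\<close>

lemma mnorm_telescope:
  fixes \<theta> :: "nat \<Rightarrow> real mat"
  assumes \<theta>: "\<And>i. \<theta> i \<in> carrier_mat m n"
  shows "mnorm (\<theta> (a + i) - \<theta> a)
    \<le> (\<Sum>j<a + i. mnorm (\<theta> (Suc j) - \<theta> j)) - (\<Sum>j<a. mnorm (\<theta> (Suc j) - \<theta> j))"
proof (induction i)
  case 0
  have "mnorm (\<theta> a - \<theta> a) \<le> 0"
    unfolding mnorm_def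
  proof (rule cSup_least, goal_cases)
    case 1
    have "0\<^sub>v (dim_col (\<theta> a - \<theta> a)) \<in> carrier_vec (dim_col (\<theta> a - \<theta> a))
        \<and> vnorm (0\<^sub>v (dim_col (\<theta> a - \<theta> a))) \<le> 1"
      by simp
    then show ?case by blast
  next
    case (2 y)
    then obtain v where v: "y = vnorm ((\<theta> a - \<theta> a) *\<^sub>v v)" "v \<in> carrier_vec n"
      using \<theta> by (auto simp: carrier_matD[OF \<theta>])
    have "(\<theta> a - \<theta> a) *\<^sub>v v = 0\<^sub>v m"
      using \<theta>[of a] v(2) by (subst minus_mult_distrib_mat_vec[of _ m n]) auto
    then show ?case by (simp add: v(1))
  qed
  then show ?case by simp
next
  case (Suc i)
  have "\<theta> (a + Suc i) - \<theta> a = (\<theta> (Suc (a + i)) - \<theta> (a + i)) + (\<theta> (a + i) - \<theta> a)"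
    using \<theta> by (intro eq_matI) (auto simp: carrier_matD[OF \<theta>])
  also have "mnorm \<dots> \<le> mnorm (\<theta> (Suc (a + i)) - \<theta> (a + i)) + mnorm (\<theta> (a + i) - \<theta> a)"
    by (intro mnorm_add[of _ m n] minus_carrier_mat \<theta>)
  finally show ?case using Suc by simp
qed

section \<open>The closed loop\<close>

lemma dim_foldr_append_vec: "dim_vec (foldr (@\<^sub>v) vs vNil) = sum_list (map dim_vec vs)"
  by (induction vs) auto

lemma regressor_carrier:
  assumes "y \<in> signals (d_y D)" "u \<in> signals (d_u D)"
  shows "regressor D y u t \<in> carrier_vec (n_phi D)"
proof -
  have dims: "map dim_vec (map (\<lambda>i. y (t - int i)) [0..<n_y D] @ map (\<lambda>i. u (t - int i)) [0..<n_u D])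
      = map (\<lambda>_. d_y D) [0..<n_y D] @ map (\<lambda>_. d_u D) [0..<n_u D]"
    using assms by (simp add: signals_def)
  then show ?thesis
    unfolding carrier_dim_vec regressor_def dim_foldr_append_vec n_phi_def dims
    by (simp add: sum_list_triv)
qed

section \<open>From integer times to natural-number offsets\<close>

lemma sum_int_interval_shift:
  fixes g :: "int \<Rightarrow> real"
  shows "(\<Sum>j\<in>{s..<s + int n}. g j) = (\<Sum>i<n. g (s + int i))"
  by (rule sum.reindex_bij_witness[of _ "\<lambda>i. s + int i" "\<lambda>j. nat (j - s)"]) auto

text \<open>Substituting \<open>\<tau> = t0 + int a\<close> and \<open>t = t0 + int (a + n)\<close>
  reaches all admissible pairs of times, makes every exponent a natural number and brings the bound
  into the form of \<open>has_convolution_bound\<close>.\<close>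

lemma convolution_ineq_iff:
  fixes z1 :: "int \<Rightarrow> real vec"
  shows "convolution_ineq D c lam t0 w r y u z1 \<longleftrightarrow>
    (\<forall>a n. vnorm (regressor D y u (t0 + int (a + n)) @\<^sub>v z1 (t0 + int (a + n)))
      \<le> c * (lam ^ n * vnorm (regressor D y u (t0 + int a) @\<^sub>v z1 (t0 + int a))
          + conv lam (\<lambda>i. vnorm (r (t0 + int (a + i))) + vnorm (w (t0 + int (a + i)))) n)
        + c * vnorm (r (t0 + int (a + n))))" (is "_ \<longleftrightarrow> (\<forall>a n. ?x (a + n) \<le> ?R a n)")
proof -
  let ?b = "\<lambda>j. vnorm (r j) + vnorm (w j)"
  have eq: "c * lam powi ((t0 + int (a + n)) - (t0 + int a)) * ?x a
      + (\<Sum>j\<in>{t0 + int a..<t0 + int (a + n)}. c * lam powi ((t0 + int (a + n)) - j - 1) * ?b j)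
      + c * vnorm (r (t0 + int (a + n))) = ?R a n" for a n
  proof -
    have "(\<Sum>j\<in>{t0 + int a..<t0 + int (a + n)}. c * lam powi ((t0 + int (a + n)) - j - 1) * ?b j)
        = (\<Sum>i<n. c * lam powi ((t0 + int (a + n)) - (t0 + int a + int i) - 1) * ?b (t0 + int a + int i))"
      using sum_int_interval_shift[of _ "t0 + int a" n] by (simp add: add.assoc)
    also have "\<dots> = (\<Sum>i<n. c * (lam ^ (n - Suc i) * ?b (t0 + int (a + i))))"
    proof (intro sum.cong refl)
      fix i assume "i \<in> {..<n}"
      then have *: "(t0 + int (a + n)) - (t0 + int a + int i) - 1 = int (n - Suc i)" by auto
      then show "c * lam powi ((t0 + int (a + n)) - (t0 + int a + int i) - 1) * ?b (t0 + int a + int i)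
          = c * (lam ^ (n - Suc i) * ?b (t0 + int (a + i)))"
        unfolding * by (simp add: power_int_of_nat add.assoc)
    qed
    also have "\<dots> = c * conv lam (\<lambda>i. ?b (t0 + int (a + i))) n"
      by (simp add: conv_def sum_distrib_left)
    finally show ?thesis by (simp add: distrib_left mult.assoc)
  qed
  show ?thesis
  proof
    assume L: "convolution_ineq D c lam t0 w r y u z1"
    show "\<forall>a n. ?x (a + n) \<le> ?R a n"
    proof (intro allI)
      fix a n
      have "t0 \<le> t0 + int a \<and> t0 + int a \<le> t0 + int (a + n)" by simp
      from L[unfolded convolution_ineq_def, rule_format, OF this]
      show "?x (a + n) \<le> ?R a n" unfolding eq .
    qed
  next
    assume R: "\<forall>a n. ?x (a + n) \<le> ?R a n"
    show "convolution_ineq D c lam t0 w r y u z1"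
      unfolding convolution_ineq_def
    proof (intro allI impI, goal_cases)
      case (1 \<tau> t)
      define a n where "a = nat (\<tau> - t0)" and "n = nat (t - \<tau>)"
      have *: "\<tau> = t0 + int a" "t = t0 + int (a + n)" using 1 by (auto simp: a_def n_def)
      show ?case unfolding * eq using R by blast
    qed
  qed
qed

theorem theorem2:
  fixes D :: dims and C :: controller
    and f :: "real vec \<Rightarrow> real vec" and S :: "real mat set" and c lam :: real
  assumes "f \<in> carrier_vec (n_phi D) \<rightarrow> carrier_vec (d_p D)"
    and "bounded_gain (n_phi D) f"
    and "S \<subseteq> carrier_mat (d_p D) (d_y D)"
    and "bounded_mats S"
    and "is_controller D C"
    and "1 \<le> c" and "0 < lam" and "lam < 1"
    and "convolution_bound_ti D C f S c lam"
  shows "\<exists>\<epsilon>>0. \<forall>c0\<ge>0. \<exists>lam' \<gamma>. 0 < lam' \<and> lam' < 1 \<and> 0 < \<gamma> \<and>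
           convolution_bound_tv D C f (time_variation_class (d_p D) (d_y D) S c0 \<epsilon>) \<gamma> lam'"
proof -
  obtain nu where nu: "0 < nu" "\<And>x. x \<in> carrier_vec (n_phi D) \<Longrightarrow> vnorm (f x) \<le> nu * vnorm x"
    using assms(2) unfolding bounded_gain_def by blast
  obtain \<epsilon> where eps: "0 < \<epsilon>" and drift: "\<forall>c0\<ge>0. \<exists>lam' \<gamma>. 0 < lam' \<and> lam' < 1 \<and> 1 \<le> \<gamma> \<and>
    (\<forall>x b rho W. (\<forall>n. 0 \<le> x n \<and> 0 \<le> rho n \<and> rho n \<le> b n) \<longrightarrow> mono W \<longrightarrow>
      (\<forall>i n. W (i + n) - W i \<le> c0 + \<epsilon> * real n) \<longrightarrow>
      has_convolution_bound c lam x (\<lambda>a i. b (a + i) + nu * (W (a + i) - W a) * x (a + i)) rho \<longrightarrow>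
      has_convolution_bound \<gamma> lam' x (\<lambda>a i. b (a + i)) rho)"
    using convolution_bound_slow_drift[OF assms(6,7,8) nu(1)] by blast
  show ?thesis
  proof (rule exI[of _ \<epsilon>], intro conjI allI impI eps)
    fix c0 :: real assume c0: "0 \<le> c0"
    from drift[rule_format, OF c0] obtain lam' \<gamma> where
      l': "0 < lam'" "lam' < 1" "1 \<le> \<gamma>" and
      bound: "\<And>x b rho W. \<lbrakk>\<forall>n. 0 \<le> x n \<and> 0 \<le> rho n \<and> rho n \<le> b n; mono W;
        \<forall>i n. W (i + n) - W i \<le> c0 + \<epsilon> * real n;
        has_convolution_bound c lam x (\<lambda>a i. b (a + i) + nu * (W (a + i) - W a) * x (a + i)) rho\<rbrakk>
        \<Longrightarrow> has_convolution_bound \<gamma> lam' x (\<lambda>a i. b (a + i)) rho"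
      by blast
    have "convolution_bound_tv D C f (time_variation_class (d_p D) (d_y D) S c0 \<epsilon>) \<gamma> lam'"
      unfolding convolution_bound_tv_def
    proof (intro conjI l' ballI allI impI)
      fix \<theta> t0 \<phi>0 z10 z20 w r y u z1 z2
      assume \<theta>: "\<theta> \<in> time_variation_class (d_p D) (d_y D) S c0 \<epsilon>"
        and \<phi>0: "\<phi>0 \<in> carrier_vec (n_phi D)" and z10: "z10 \<in> carrier_vec (l_1 D)"
        and z20: "z20 \<in> ctrl_X C" and w: "w \<in> signals (d_y D)" and r: "r \<in> signals (d_r D)"
        and y: "y \<in> signals (d_y D)" and u: "u \<in> signals (d_u D)"
        and loop: "tv_plant D f \<theta> t0 \<phi>0 w y u \<and> control_law D C t0 z10 z20 r y u z1 z2"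
      let ?phi = "regressor D y u"
      let ?var = "\<lambda>t. mnorm (\<theta> (t + 1) - \<theta> t)"
      define x where "x n = vnorm (?phi (t0 + int n) @\<^sub>v z1 (t0 + int n))" for n
      define b where "b n = vnorm (r (t0 + int n)) + vnorm (w (t0 + int n))" for n
      define rho where "rho n = vnorm (r (t0 + int n))" for n
      define W where "W n = (\<Sum>i<n. ?var (t0 + int i))" for n
      define wk where "wk k t = w t + transpose_mat (\<theta> t - \<theta> k) *\<^sub>v f (?phi t)" for k t
      have \<theta>S: "\<theta> t \<in> S" for t using \<theta> by (simp add: time_variation_class_def)
      then have \<theta>c: "\<theta> t \<in> carrier_mat (d_p D) (d_y D)" for t using assms(3) by blast
      have phi: "?phi t \<in> carrier_vec (n_phi D)" for t by (rule regressor_carrier[OF y u])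
      then have fphi: "f (?phi t) \<in> carrier_vec (d_p D)" for t using assms(1) by blast
      have wc: "w t \<in> carrier_vec (d_y D)" for t using w by (simp add: signals_def)
      have pert: "transpose_mat (\<theta> t - \<theta> k) *\<^sub>v f (?phi t) \<in> carrier_vec (d_y D)" for k t
        by (intro mult_mat_vec_carrier[of _ _ "d_p D"] fphi)
          (simp only: transpose_carrier_mat minus_carrier_mat[OF \<theta>c])
      \<comment> \<open>Membership in \<open>signals\<close> concerns all integer times, including
        those before \<open>t0\<close>.\<close>
      have wkc: "wk k \<in> signals (d_y D)" for k
        using wc pert by (simp add: signals_def wk_def)
      \<comment> \<open>Only the parameter is frozen at \<open>k\<close>; the start remains
        \<open>t0\<close>, on which the controller maps depend. The control law therefore carries
        over unchanged.\<close>
      have "ti_plant D f (\<theta> k) t0 \<phi>0 (wk k) y u" for k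
        unfolding ti_plant_def
      proof (intro conjI allI impI)
        show "?phi t0 = \<phi>0" using loop by (simp add: tv_plant_def)
        fix t assume "t0 \<le> t"
        then have "y (t + 1) = transpose_mat (\<theta> t) *\<^sub>v f (?phi t) + w t"
          using loop by (simp add: tv_plant_def)
        moreover have "transpose_mat (\<theta> t - \<theta> k) *\<^sub>v f (?phi t)
            = transpose_mat (\<theta> t) *\<^sub>v f (?phi t) - transpose_mat (\<theta> k) *\<^sub>v f (?phi t)"
          unfolding transpose_minus[OF \<theta>c \<theta>c]
          by (rule minus_mult_distrib_mat_vec[of _ "d_y D" "d_p D"])
            (simp_all only: transpose_carrier_mat \<theta>c fphi)
        ultimately show "y (t + 1) = transpose_mat (\<theta> k) *\<^sub>v f (?phi t) + wk k t"
          using wc \<theta>c by (intro eq_vecI) (auto simp: wk_def carrier_matD[OF \<theta>c] carrier_vecD[OF wc])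
      qed
      then have ti: "convolution_ineq D c lam t0 (wk k) r y u z1" for k
        using assms(9) \<theta>S \<phi>0 z10 z20 wkc r y u loop unfolding convolution_bound_ti_def by blast
      have W_step: "W (i + n) - W i = (\<Sum>t\<in>{t0 + int i..<t0 + int i + int n}. ?var t)" for i n
        unfolding sum_int_interval_shift by (induction n) (simp_all add: W_def add.assoc)
      have "mono W"
        unfolding W_def by (intro monoI sum_mono2) (auto simp: mnorm_nonneg)
      \<comment> \<open>The mismatch is at most the variation since freezing, times the gain of
        \<open>f\<close>, times the norm of the stacked state.\<close>
      have wk_le: "vnorm (wk (t0 + int a) (t0 + int (a + i)))
          \<le> vnorm (w (t0 + int (a + i))) + nu * (W (a + i) - W a) * x (a + i)" for a i
      proof -
        let ?k = "t0 + int a" and ?t = "t0 + int (a + i)"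
        have "mnorm (\<theta> ?t - \<theta> ?k) \<le> W (a + i) - W a"
          using mnorm_telescope[of "\<lambda>i. \<theta> (t0 + int i)" "d_p D" "d_y D" a i] \<theta>c
          by (simp add: W_def add_ac)
        moreover have "vnorm (f (?phi ?t)) \<le> nu * x (a + i)"
          using nu(2)[OF phi[of ?t]] nu(1) vnorm_append_ge[of "?phi ?t" "z1 ?t"]
          by (smt (verit) mult_left_mono x_def)
        ultimately have "mnorm (\<theta> ?t - \<theta> ?k) * vnorm (f (?phi ?t)) \<le> (W (a + i) - W a) * (nu * x (a + i))"
          by (intro mult_mono' mnorm_nonneg vnorm_nonneg)
        moreover have "vnorm (transpose_mat (\<theta> ?t - \<theta> ?k) *\<^sub>v f (?phi ?t))
            \<le> mnorm (\<theta> ?t - \<theta> ?k) * vnorm (f (?phi ?t))"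
          by (rule vnorm_mult_transpose_le[OF minus_carrier_mat[OF \<theta>c] fphi])
        moreover have "vnorm (wk ?k ?t) \<le> vnorm (w ?t)
            + vnorm (transpose_mat (\<theta> ?t - \<theta> ?k) *\<^sub>v f (?phi ?t))"
          unfolding wk_def by (rule vnorm_add[OF wc pert])
        ultimately show ?thesis by (simp add: mult_ac)
      qed
      have "has_convolution_bound \<gamma> lam' x (\<lambda>a i. b (a + i)) rho"
      proof (rule bound)
        show "\<forall>n. 0 \<le> x n \<and> 0 \<le> rho n \<and> rho n \<le> b n"
          by (simp add: x_def rho_def b_def vnorm_nonneg)
        show "mono W" by fact
        show "\<forall>i n. W (i + n) - W i \<le> c0 + \<epsilon> * real n"
        proof (intro allI)
          fix i n
          show "W (i + n) - W i \<le> c0 + \<epsilon> * real n"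
          \<comment> \<open>The variation class constrains only nonempty intervals; the empty one is
            covered by \<open>c0\<close> being nonnegative.\<close>
          proof (cases "n = 0")
            case False
            then have "t0 + int i < t0 + int i + int n" by simp
            then have "(\<Sum>t\<in>{t0 + int i..<t0 + int i + int n}. ?var t)
                \<le> c0 + \<epsilon> * of_int (t0 + int i + int n - (t0 + int i))"
              using \<theta> unfolding time_variation_class_def by blast
            then show ?thesis unfolding W_step by simp
          qed (simp add: c0)
        qed
        show "has_convolution_bound c lam x (\<lambda>a i. b (a + i) + nu * (W (a + i) - W a) * x (a + i)) rho"
          unfolding has_convolution_bound_def
        proof (intro allI)
          fix a n
          \<comment> \<open>The freezing time is the starting time of the bound, so the variation is
            counted from \<open>a\<close>.\<close>
          have "x (a + n) \<le> c * (lam ^ n * x a + conv lam (\<lambda>i. vnorm (r (t0 + int (a + i)))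
              + vnorm (wk (t0 + int a) (t0 + int (a + i)))) n) + c * rho (a + n)"
            using ti[of "t0 + int a"] unfolding convolution_ineq_iff x_def rho_def by blast
          also have "\<dots> \<le> c * (lam ^ n * x a
              + conv lam (\<lambda>i. b (a + i) + nu * (W (a + i) - W a) * x (a + i)) n) + c * rho (a + n)"
          proof (intro add_right_mono mult_left_mono add_left_mono conv_mono)
            fix i
            show "vnorm (r (t0 + int (a + i))) + vnorm (wk (t0 + int a) (t0 + int (a + i)))
                \<le> b (a + i) + nu * (W (a + i) - W a) * x (a + i)"
              using wk_le[of a i] unfolding b_def by linarith
          qed (use assms(6,7) in \<open>simp_all add: vnorm_nonneg\<close>)
          finally show "x (a + n) \<le> c * (lam ^ n * x a
              + conv lam (\<lambda>i. b (a + i) + nu * (W (a + i) - W a) * x (a + i)) n) + c * rho (a + n)" .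
        qed
      qed
      then show "convolution_ineq D \<gamma> lam' t0 w r y u z1"
        unfolding convolution_ineq_iff has_convolution_bound_def x_def b_def rho_def .
    qed
    moreover have "0 < \<gamma>" using l' by simp
    ultimately show "\<exists>lam' \<gamma>. 0 < lam' \<and> lam' < 1 \<and> 0 < \<gamma> \<and>
        convolution_bound_tv D C f (time_variation_class (d_p D) (d_y D) S c0 \<epsilon>) \<gamma> lam'"
      using l' by blast
  qed
qed

end
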